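(* Let $\Gamma$ be a totally ordered abelian group, with divisible hull $\Gamma_{\mathbb Q}$ and small-extensions closure $\Gamma_{\mathrm{sme}}\supset\Gamma_{\mathbb Q}$. Then $\Gamma_{\mathbb Q}$ is dense in $\Gamma_{\mathrm{sme}}$; that is, for all $\alpha<\beta$ in $\Gamma_{\mathrm{sme}}$ such that the open interval $(\alpha,\beta)=\{x\in\Gamma_{\mathrm{sme}}\mid\alpha<x<\beta\}$ is non-empty, there exists $q\in\Gamma_{\mathbb Q}$ with $\alpha<q<\beta$.
   Context: Ordered sets are totally ordered; ordered groups are totally ordered abelian groups; embeddings strictly preserve order. Setting. $\Gamma_{\mathbb Q}=\Gamma\otimes_{\mathbb Z}\mathbb Q$ is the divisible hull with its natural order. A subgroup $H$ of an ordered group is convex if $|\rho|\le|\gamma|$, $\gamma\in H$ imply $\rho\in H$; it is principal if it is the convex subgroup generated by one element. $I=\mathrm{Prin}(\Gamma)=\mathrm{Prin}(\Gamma_{\mathbb Q})$ is the set of non-zero principal convex subgroups (canonically the same for $\Gamma$ and $\Gamma_{\mathbb Q}$), ordered by decreasing inclusion. For $i\in I$, $H_i\subset\Gamma_{\mathbb Q}$ is the corresponding subgroup, $H_i^*$ is the largest convex subgroup properly contained in $H_i$, and $Q_i=H_i/H_i^*$ (of rank one). For an ordered set $J$ and ordered groups $G_j$, the Hahn product $(\prod_{j\in J}G_j)_{\mathrm{lex}}$ is the group of elements of $\prod_j G_j$ with well-ordered support, ordered lexicographically; it is written $G^J_{\mathrm{lex}}$ if all $G_j=G$ (and $\mathbb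 R^\emptyset_{\mathrm{lex}}=\{0\}$). Fix ordered-group embeddings $Q_i\hookrightarrow\mathbb R$, and fix (Hahn's embedding theorem) an immediate embedding of $\Gamma_{\mathbb Q}$ into $\mathbb H(\Gamma_{\mathbb Q})=(\prod_{i\in I}Q_i)_{\mathrm{lex}}$, i.e. an ordered-group embedding such that an element generating $H_i$ as a convex subgroup has image with zero coordinates at all $j<i$ and with $i$-th coordinate its class in $Q_i$. Identify $\Gamma\subset\Gamma_{\mathbb Q}\subset\mathbb H(\Gamma_{\mathbb Q})\subset\mathbb R^I_{\mathrm{lex}}$. $\mathrm{Init}(I)$ is the set of initial segments of $I$ (including $\emptyset$ and $I$), ordered by inclusion. $\mathbb I=I\sqcup\{i_S\mid S\in\mathrm{Init}(I)\}$ with the total order extending that of $I$ such that $S<i_S<I\setminus S$ for all $S$, and $i_S<i_T\Leftrightarrow S\subsetneq T$. $I_S=I\cup\{i_S\}\subset\mathbb I$. For $J\subset J'\subset \mathbb I$, regard $\mathbb R^J_{\mathrm{lex}}\subset\mathbb R^{J'}_{\mathrm{lex}}$ via extension by zero. For $\beta\in\mathbb R^I_{\mathrm{lex}}$ and $S\in\mathrm{Init}(I)$ let $\beta_S\in\mathbb R^S_{\mathrm{lex}}$ be the restriction of $\beta$ to $S$; for $\rho\in \mathbb R^S_{\mathrm{lex}}$ let $(\rho\mid0)$ be its extension by zero. An element $\rho\in\mathbb R^S_{\mathrm{lex}}$ is commensurable if $\rho=b_S$ for some $b\in\Gamma_{\mathbb Q}$, incommensurable otherwise. $\mathrm{EqRk}(\Gamma)$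 is the set of minimal incommensurable elements: those $\beta\in\mathbb R^I_{\mathrm{lex}}$ for which there is a smallest $S\in\mathrm{Init}(I)$ with $\beta_S$ incommensurable, and $\beta=(\beta_S\mid0)$ for this $S$. $\mathrm{IncRk}(\Gamma)$ is the set of all elements $b^{\pm}=(b\mid\pm1\mid0)\in\mathbb R^{I_S}_{\mathrm{lex}}$, with $S\in\mathrm{Init}(I)$ and $b\in\mathbb R^S_{\mathrm{lex}}$ commensurable, whose restriction to $S$ is $b$, whose $i_S$-coordinate is $\pm1$, and whose other coordinates are $0$. Finally $\Gamma_{\mathbb R}=\Gamma_{\mathbb Q}\sqcup\mathrm{EqRk}(\Gamma)$ and $\Gamma_{\mathrm{sme}}=\Gamma_{\mathbb R}\sqcup\mathrm{IncRk}(\Gamma)\subset\mathbb R^{\mathbb I}_{\mathrm{lex}}$, with the induced order. *)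

theory Defs
  imports Complex_Main "HOL-Library.Set_Algebras"
begin

section \<open>The divisible hull\<close>

primrec nsmul :: "nat \<Rightarrow> 'a::ab_group_add \<Rightarrow> 'a" where
  "nsmul 0 x = 0"
| "nsmul (Suc n) x = x + nsmul n x"

lemma nsmul_zero [simp]: "nsmul n 0 = 0"
  by (induction n) auto

lemma nsmul_one [simp]: "nsmul (Suc 0) x = x"
  by simp

lemma nsmul_add_right: "nsmul n (x + y) = nsmul n x + nsmul n y"
  by (induction n) (auto simp: algebra_simps)

lemma nsmul_add_left: "nsmul (m + n) x = nsmul m x + nsmul n x"
  by (induction m) (auto simp: algebra_simps)

lemma nsmul_nsmul: "nsmul m (nsmul n x) = nsmul (m * n) x"
  by (induction m) (auto simp: nsmul_add_left)

lemma nsmul_minus: "nsmul n (- x) = - nsmul n x"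
  by (induction n) auto

lemma nsmul_mono: "x \<le> y \<Longrightarrow> nsmul n x \<le> nsmul n (y :: 'a::linordered_ab_group_add)"
  by (induction n) (auto intro: add_mono)

lemma nsmul_strict_mono:
  "x < y \<Longrightarrow> 0 < n \<Longrightarrow> nsmul n x < nsmul n (y :: 'a::linordered_ab_group_add)"
proof (induction n)
  case (Suc n)
  then show ?case by (simp add: add_less_le_mono nsmul_mono less_imp_le)
qed simp

lemma nsmul_le_iff:
  "0 < n \<Longrightarrow> nsmul n x \<le> nsmul n y \<longleftrightarrow> x \<le> (y :: 'a::linordered_ab_group_add)"
  by (meson linorder_not_le nsmul_mono nsmul_strict_mono)

lemma nsmul_eq_iff:
  "0 < n \<Longrightarrow> nsmul n x = nsmul n y \<longleftrightarrow> x = (y :: 'a::linordered_ab_group_add)"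
  by (metis nsmul_le_iff order_antisym order_refl)

text \<open>As a localization of \<open>\<int>\<close>-modules, \<open>\<Gamma> \<otimes> \<rat>\<close> consists of the fractions \<open>a / m\<close>
  with \<open>a \<in> \<Gamma>\<close> and \<open>m > 0\<close>; since \<open>\<Gamma>\<close> is torsion-free, \<open>a / m = b / n\<close> iff \<open>n a = m b\<close>.\<close>

definition frac_rel :: "'a::linordered_ab_group_add \<times> nat \<Rightarrow> 'a \<times> nat \<Rightarrow> bool" where
  "frac_rel p q \<longleftrightarrow> 0 < snd p \<and> 0 < snd q \<and> nsmul (snd q) (fst p) = nsmul (snd p) (fst q)"

lemma part_equivp_frac_rel: "part_equivp (frac_rel :: 'a::linordered_ab_group_add \<times> nat \<Rightarrow> _)"
proof (rule part_equivpI)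
  show "\<exists>x :: 'a \<times> nat. frac_rel x x" by (intro exI[of _ "(0, 1)"]) (simp add: frac_rel_def)
  show "symp (frac_rel :: 'a \<times> nat \<Rightarrow> _)" by (auto simp: symp_def frac_rel_def)
  show "transp (frac_rel :: 'a \<times> nat \<Rightarrow> _)"
  proof (rule transpI)
    fix x y z :: "'a \<times> nat"
    assume xy: "frac_rel x y" and yz: "frac_rel y z"
    obtain a m b n c k where [simp]: "x = (a, m)" "y = (b, n)" "z = (c, k)"
      by (metis surj_pair)
    have pos: "0 < m" "0 < n" "0 < k" and e1: "nsmul n a = nsmul m b" and e2: "nsmul k b = nsmul n c"
      using xy yz by (auto simp: frac_rel_def)
    have "nsmul n (nsmul k a) = nsmul k (nsmul n a)" by (simp add: nsmul_nsmul mult.commute)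
    also have "\<dots> = nsmul m (nsmul k b)" by (simp add: e1 nsmul_nsmul mult.commute)
    also have "\<dots> = nsmul n (nsmul m c)" by (simp add: e2 nsmul_nsmul mult.commute)
    finally show "frac_rel x z" using pos by (simp add: frac_rel_def nsmul_eq_iff)
  qed
qed

quotient_type (overloaded) 'a dhull = "'a::linordered_ab_group_add \<times> nat" / partial: frac_rel
  by (rule part_equivp_frac_rel)

lift_definition dfrac :: "'a::linordered_ab_group_add \<Rightarrow> nat \<Rightarrow> 'a dhull"
  is "\<lambda>a m. if m = 0 then (0, 1) else (a, m)"
  by (auto simp: frac_rel_def)

lemma frac_cases: obtains a m where "x = dfrac a m" "0 < m"
proof -
  have "\<exists>a m. x = dfrac a m \<and> 0 < m"
  proof transfer
    fix p :: "'a \<times> nat" assume "frac_rel p p"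
    then show "\<exists>a m. frac_rel p (if m = 0 then (0, 1) else (a, m)) \<and> 0 < m"
      by (intro exI[of _ "fst p"] exI[of _ "snd p"]) (auto simp: frac_rel_def)
  qed
  then show ?thesis using that by blast
qed

lemma frac_eq_iff:
  "0 < m \<Longrightarrow> 0 < n \<Longrightarrow> dfrac a m = dfrac b n \<longleftrightarrow> nsmul n a = nsmul m b"
  by transfer (auto simp: frac_rel_def)

lemma frac_cancel: "0 < k \<Longrightarrow> 0 < m \<Longrightarrow> dfrac (nsmul k a) (k * m) = dfrac a m"
  by (subst frac_eq_iff) (auto simp: nsmul_nsmul mult.commute)

instantiation dhull :: (linordered_ab_group_add) linordered_ab_group_add
begin

lift_definition zero_dhull :: "'a dhull" is "(0, 1)"
  by (simp add: frac_rel_def)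

lift_definition plus_dhull :: "'a dhull \<Rightarrow> 'a dhull \<Rightarrow> 'a dhull"
  is "\<lambda>p q. (nsmul (snd q) (fst p) + nsmul (snd p) (fst q), snd p * snd q)"
proof -
  fix p p' q q' :: "'a \<times> nat"
  assume pp: "frac_rel p p'" and qq: "frac_rel q q'"
  obtain a m a' m' b n b' n' where [simp]: "p = (a, m)" "p' = (a', m')" "q = (b, n)" "q' = (b', n')"
    by (metis surj_pair)
  have pos: "0 < m" "0 < n" "0 < m'" "0 < n'"
    and e1: "nsmul m' a = nsmul m a'" and e2: "nsmul n' b = nsmul n b'"
    using pp qq by (auto simp: frac_rel_def)
  have 1: "nsmul (m' * n') (nsmul n a) = nsmul (m * n) (nsmul n' a')"
  proof -
    have "nsmul (m' * n') (nsmul n a) = nsmul (n' * n) (nsmul m' a)"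
      by (simp add: nsmul_nsmul ac_simps)
    then show ?thesis by (simp add: e1 nsmul_nsmul ac_simps)
  qed
  have 2: "nsmul (m' * n') (nsmul m b) = nsmul (m * n) (nsmul m' b')"
  proof -
    have "nsmul (m' * n') (nsmul m b) = nsmul (m' * m) (nsmul n' b)"
      by (simp add: nsmul_nsmul ac_simps)
    then show ?thesis by (simp add: e2 nsmul_nsmul ac_simps)
  qed
  show "frac_rel (nsmul (snd q) (fst p) + nsmul (snd p) (fst q), snd p * snd q)
          (nsmul (snd q') (fst p') + nsmul (snd p') (fst q'), snd p' * snd q')"
    using pos 1 2 by (simp add: frac_rel_def nsmul_add_right)
qed

lift_definition uminus_dhull :: "'a dhull \<Rightarrow> 'a dhull" is "\<lambda>p. (- fst p, snd p)"
  by (auto simp: frac_rel_def nsmul_minus)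

definition minus_dhull :: "'a dhull \<Rightarrow> 'a dhull \<Rightarrow> 'a dhull" where
  "minus_dhull x y = x + - y"

lift_definition less_eq_dhull :: "'a dhull \<Rightarrow> 'a dhull \<Rightarrow> bool"
  is "\<lambda>p q. nsmul (snd q) (fst p) \<le> nsmul (snd p) (fst q)"
proof -
  fix p p' q q' :: "'a \<times> nat"
  assume pp: "frac_rel p p'" and qq: "frac_rel q q'"
  obtain a m a' m' b n b' n' where [simp]: "p = (a, m)" "p' = (a', m')" "q = (b, n)" "q' = (b', n')"
    by (metis surj_pair)
  have pos: "0 < m" "0 < n" "0 < m'" "0 < n'"
    and e1: "nsmul m' a = nsmul m a'" and e2: "nsmul n' b = nsmul n b'"
    using pp qq by (auto simp: frac_rel_def)
  have "nsmul n a \<le> nsmul m b \<longleftrightarrow> nsmul (m' * n') (nsmul n a) \<le> nsmul (m' * n') (nsmul m b)"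
    using pos by (simp add: nsmul_le_iff)
  also have "nsmul (m' * n') (nsmul n a) = nsmul (n' * n) (nsmul m' a)"
    by (simp add: nsmul_nsmul ac_simps)
  also have "\<dots> = nsmul (m * n) (nsmul n' a')"
    by (simp add: e1 nsmul_nsmul ac_simps)
  also have "nsmul (m' * n') (nsmul m b) = nsmul (m' * m) (nsmul n' b)"
    by (simp add: nsmul_nsmul ac_simps)
  also have "\<dots> = nsmul (m * n) (nsmul m' b')"
    by (simp add: e2 nsmul_nsmul ac_simps)
  finally show "(nsmul (snd q) (fst p) \<le> nsmul (snd p) (fst q)) =
      (nsmul (snd q') (fst p') \<le> nsmul (snd p') (fst q'))"
    using pos by (simp add: nsmul_le_iff)
qed

definition less_dhull :: "'a dhull \<Rightarrow> 'a dhull \<Rightarrow> bool" where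
  "less_dhull x y \<longleftrightarrow> x \<le> y \<and> \<not> y \<le> x"

lemma plus_frac: "0 < m \<Longrightarrow> 0 < n \<Longrightarrow> dfrac a m + dfrac b n = dfrac (nsmul n a + nsmul m b) (m * n)"
  by transfer (auto simp: frac_rel_def)

lemma zero_frac: "0 < m \<Longrightarrow> 0 = dfrac 0 m"
  by transfer (auto simp: frac_rel_def)

lemma uminus_frac: "0 < m \<Longrightarrow> - dfrac a m = dfrac (- a) m"
  by transfer (auto simp: frac_rel_def)

lemma le_frac: "0 < m \<Longrightarrow> 0 < n \<Longrightarrow> dfrac a m \<le> dfrac b n \<longleftrightarrow> nsmul n a \<le> nsmul m b"
  by transfer auto

lemma frac_common2:
  obtains a b m where "x = dfrac a m" "y = dfrac b m" "0 < m"
proof -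
  obtain a m b n where x: "x = dfrac a m" "0 < m" and y: "y = dfrac b n" "0 < n"
    by (meson frac_cases)
  have "x = dfrac (nsmul n a) (n * m)" "y = dfrac (nsmul m b) (n * m)"
    using x y frac_cancel[of n m a] frac_cancel[of m n b] by (simp_all add: mult.commute)
  then show ?thesis using that x y by simp
qed

lemma frac_common3:
  obtains a b c m where "x = dfrac a m" "y = dfrac b m" "z = dfrac c m" "0 < m"
proof -
  obtain a b m where x: "x = dfrac a m" "y = dfrac b m" "0 < m" by (rule frac_common2)
  obtain c n where z: "z = dfrac c n" "0 < n" by (rule frac_cases)
  have "x = dfrac (nsmul n a) (n * m)" "y = dfrac (nsmul n b) (n * m)" "z = dfrac (nsmul m c) (n * m)"
    using x z frac_cancel[of n m a] frac_cancel[of n m b] frac_cancel[of m n c]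
    by (simp_all add: mult.commute)
  then show ?thesis using that x z by simp
qed

lemma plus_frac_same: "0 < m \<Longrightarrow> dfrac a m + dfrac b m = dfrac (a + b) m"
  by (simp add: plus_frac frac_cancel flip: nsmul_add_right)

lemma le_frac_same: "0 < m \<Longrightarrow> dfrac a m \<le> dfrac b m \<longleftrightarrow> a \<le> b"
  by (simp add: le_frac nsmul_le_iff)

instance
proof
  fix x y z :: "'a dhull"
  show "x + y + z = x + (y + z)"
    by (rule frac_common3[of x y z]) (simp add: plus_frac_same add.assoc)
  show "x + y = y + x"
    by (rule frac_common2[of x y]) (simp add: plus_frac_same add.commute)
  show "0 + x = x"
    by (rule frac_cases[of x]) (metis zero_frac plus_frac_same add_0)
  show "- x + x = 0"
    by (rule frac_cases[of x]) (metis uminus_frac plus_frac_same zero_frac left_minus)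
  show "x - y = x + - y" by (simp add: minus_dhull_def)
  show "x < y \<longleftrightarrow> x \<le> y \<and> \<not> y \<le> x" by (simp add: less_dhull_def)
  show "x \<le> x" by (rule frac_cases[of x]) (simp add: le_frac_same)
  show "x \<le> y \<Longrightarrow> y \<le> z \<Longrightarrow> x \<le> z"
    by (rule frac_common3[of x y z]) (simp add: le_frac_same)
  show "x \<le> y \<Longrightarrow> y \<le> x \<Longrightarrow> x = y"
    by (rule frac_common2[of x y]) (simp add: le_frac_same)
  show "x \<le> y \<Longrightarrow> z + x \<le> z + y"
    by (rule frac_common3[of x y z]) (simp add: le_frac_same plus_frac_same)
  show "x \<le> y \<or> y \<le> x"
    by (rule frac_common2[of x y]) (auto simp: le_frac_same)
qed

end

definition to_dhull :: "'a::linordered_ab_group_add \<Rightarrow> 'a dhull" where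
  "to_dhull a = dfrac a 1"

lemma to_dhull_add: "to_dhull (a + b) = to_dhull a + to_dhull b"
  by (simp add: to_dhull_def plus_frac_same)

lemma to_dhull_le_iff: "to_dhull a \<le> to_dhull b \<longleftrightarrow> a \<le> b"
  by (simp add: to_dhull_def le_frac_same)

lemma nsmul_frac: "0 < m \<Longrightarrow> nsmul n (dfrac a m) = dfrac (nsmul n a) m"
  by (induction n) (auto simp: plus_frac_same zero_frac[of m])

lemma dhull_divisible: "0 < n \<Longrightarrow> \<exists>y. nsmul n y = (x :: 'a::linordered_ab_group_add dhull)"
proof (rule frac_cases[of x])
  fix a :: 'a and m :: nat
  assume "0 < n" "0 < m" "x = dfrac a m"
  then show ?thesis by (intro exI[of _ "dfrac a (n * m)"]) (simp add: nsmul_frac frac_cancel)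
qed

lemma dhull_multiple:
  "\<exists>n a. 0 < n \<and> nsmul n x = to_dhull (a :: 'a::linordered_ab_group_add)"
proof (rule frac_cases[of x])
  fix a :: 'a and m :: nat
  assume "0 < m" "x = dfrac a m"
  then have "nsmul m x = to_dhull a"
    using frac_cancel[of m 1 a] by (simp add: nsmul_frac to_dhull_def)
  then show ?thesis using \<open>0 < m\<close> by blast
qed


section \<open>Principal convex subgroups\<close>

definition gabs :: "'a::linordered_ab_group_add \<Rightarrow> 'a" where
  "gabs x = max x (- x)"

definition convex_subgroup :: "'a::linordered_ab_group_add set \<Rightarrow> bool" where
  "convex_subgroup H \<longleftrightarrow>
     0 \<in> H \<and> (\<forall>x\<in>H. \<forall>y\<in>H. x + y \<in> H) \<and> (\<forall>x\<in>H. - x \<in> H) \<and>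
     (\<forall>\<gamma>\<in>H. \<forall>\<rho>. gabs \<rho> \<le> gabs \<gamma> \<longrightarrow> \<rho> \<in> H)"

definition conv_gen :: "'a::linordered_ab_group_add \<Rightarrow> 'a set" where
  "conv_gen x = \<Inter>{H. convex_subgroup H \<and> x \<in> H}"

definition Prin :: "'a::linordered_ab_group_add set set" where
  "Prin = range conv_gen - {{0}}"

lemma gabs_zero [simp]: "gabs 0 = 0"
  by (simp add: gabs_def)

lemma gabs_nonneg: "0 \<le> gabs x"
  by (cases "0 \<le> x") (auto simp: gabs_def le_max_iff_disj)

lemma gabs_eq_zero [simp]: "gabs x = 0 \<longleftrightarrow> x = 0"
  by (auto simp: gabs_def max_def split: if_splits)

lemma gabs_le_zero [simp]: "gabs x \<le> 0 \<longleftrightarrow> x = 0"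
  by (auto simp: gabs_def)

lemma gabs_minus [simp]: "gabs (- x) = gabs x"
  by (simp add: gabs_def max.commute)

lemma gabs_triangle: "gabs (x + y) \<le> gabs x + gabs y"
proof -
  have "x \<le> gabs x" "- x \<le> gabs x" "y \<le> gabs y" "- y \<le> gabs y"
    by (auto simp: gabs_def)
  then have "x + y \<le> gabs x + gabs y" "- x + - y \<le> gabs x + gabs y"
    by (meson add_mono)+
  then show ?thesis by (simp add: gabs_def add.commute)
qed

lemma gabs_nsmul: "gabs (nsmul n x) = nsmul n (gabs x)"
proof (cases "0 \<le> x")
  case True
  then have "0 \<le> nsmul n x" using nsmul_mono[of 0 x n] by simp
  then show ?thesis using True by (auto simp: gabs_def max_def)
next
  case False
  then have "nsmul n x \<le> 0" using nsmul_mono[of x 0 n] by simp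
  then have "gabs (nsmul n x) = - nsmul n x" by (auto simp: gabs_def max_def)
  moreover have "gabs x = - x" using False by (auto simp: gabs_def max_def)
  ultimately show ?thesis by (simp add: nsmul_minus)
qed

lemma convex_subgroup_linear:
  assumes "convex_subgroup H" "convex_subgroup K"
  shows "H \<subseteq> K \<or> K \<subseteq> H"
  using assms unfolding convex_subgroup_def by (meson linear subsetI)

lemma convex_subgroup_conv_gen: "convex_subgroup (conv_gen x)"
  unfolding convex_subgroup_def conv_gen_def by simp blast

lemma conv_gen_self: "x \<in> conv_gen x"
  by (simp add: conv_gen_def)

lemma conv_gen_least: "convex_subgroup H \<Longrightarrow> x \<in> H \<Longrightarrow> conv_gen x \<subseteq> H"
  by (auto simp: conv_gen_def)

lemma nsmul_mem: "convex_subgroup H \<Longrightarrow> x \<in> H \<Longrightarrow> nsmul n x \<in> H"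
  by (induction n) (auto simp: convex_subgroup_def)

lemma conv_gen_iff: "y \<in> conv_gen x \<longleftrightarrow> (\<exists>n. gabs y \<le> nsmul n (gabs x))"
proof
  let ?H = "{y. \<exists>n. gabs y \<le> nsmul n (gabs x)}"
  have "convex_subgroup ?H"
    unfolding convex_subgroup_def
  proof (intro conjI ballI allI impI)
    show "0 \<in> ?H" by (auto intro: exI[of _ 0])
    fix y z assume "y \<in> ?H" "z \<in> ?H"
    then obtain m n where "gabs y \<le> nsmul m (gabs x)" "gabs z \<le> nsmul n (gabs x)" by auto
    then have "gabs (y + z) \<le> nsmul (m + n) (gabs x)"
      unfolding nsmul_add_left by (meson add_mono gabs_triangle order_trans)
    then show "y + z \<in> ?H" by blast
  qed (auto intro: order_trans)
  moreover have "x \<in> ?H" by (auto intro!: exI[of _ 1])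
  ultimately show "y \<in> conv_gen x \<Longrightarrow> \<exists>n. gabs y \<le> nsmul n (gabs x)"
    using conv_gen_least by blast
  assume "\<exists>n. gabs y \<le> nsmul n (gabs x)"
  then obtain n where "gabs y \<le> gabs (nsmul n x)" by (auto simp: gabs_nsmul)
  then show "y \<in> conv_gen x"
    using nsmul_mem[OF convex_subgroup_conv_gen conv_gen_self] convex_subgroup_conv_gen
    unfolding convex_subgroup_def by blast
qed

lemma conv_gen_eq_zero_iff: "conv_gen x = {0} \<longleftrightarrow> x = (0 :: 'a::linordered_ab_group_add)"
proof
  show "conv_gen x = {0} \<Longrightarrow> x = 0" using conv_gen_self[of x] by simp
  show "x = 0 \<Longrightarrow> conv_gen x = {0}" by (auto simp: conv_gen_iff)
qed

lemma PrinE: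
  assumes "i \<in> Prin"
  obtains x where "i = conv_gen x" "x \<noteq> 0"
proof -
  obtain x where "i = conv_gen x" "i \<noteq> {0}"
    using assms unfolding Prin_def by blast
  then show ?thesis using that[of x] conv_gen_eq_zero_iff[of x] by simp
qed

lemma gabs_to_dhull: "gabs (to_dhull a) = to_dhull (gabs a)"
proof -
  have "to_dhull (- a) = - to_dhull a"
    by (simp add: to_dhull_def uminus_frac)
  moreover have "to_dhull (max a b) = max (to_dhull a) (to_dhull b)" for b
    by (simp add: max_def to_dhull_le_iff)
  ultimately show ?thesis by (simp add: gabs_def)
qed

lemma nsmul_to_dhull: "nsmul n (to_dhull a) = to_dhull (nsmul n a)"
  by (simp add: to_dhull_def nsmul_frac)

lemma vimage_conv_gen: "to_dhull -` conv_gen (to_dhull a) = conv_gen a"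
  by (auto simp: conv_gen_iff gabs_to_dhull nsmul_to_dhull to_dhull_le_iff)

lemma conv_gen_nsmul: "0 < n \<Longrightarrow> conv_gen (nsmul n x) = conv_gen x"
proof (rule antisym)
  assume "0 < n"
  then obtain m where m: "n = Suc m" by (cases n) auto
  have "gabs x \<le> gabs (nsmul n x)"
    using nsmul_mono[OF gabs_nonneg[of x], of m]
    by (subst gabs_nsmul) (simp add: m)
  then have "x \<in> conv_gen (nsmul n x)"
    by (subst conv_gen_iff) (auto intro!: exI[of _ 1])
  then show "conv_gen x \<subseteq> conv_gen (nsmul n x)"
    by (rule conv_gen_least[OF convex_subgroup_conv_gen])
  show "conv_gen (nsmul n x) \<subseteq> conv_gen x"
    by (intro conv_gen_least nsmul_mem convex_subgroup_conv_gen conv_gen_self)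
qed

lemma Prin_dhull: "\<exists>a. x = conv_gen (to_dhull a)" if "x \<in> range conv_gen"
  using that dhull_multiple conv_gen_nsmul by (metis imageE)

text \<open>The canonical identification of \<open>Prin(\<Gamma>\<^sub>\<rat>)\<close> with \<open>Prin(\<Gamma>)\<close>.\<close>

lemma Prin_dhull_bij:
  "bij_betw (\<lambda>H. to_dhull -` H) Prin (Prin :: 'a::linordered_ab_group_add set set)"
proof -
  have z: "to_dhull (0 :: 'a) = 0" by (simp add: to_dhull_def flip: zero_frac)
  have inj0: "to_dhull a = 0 \<longleftrightarrow> a = 0" for a :: 'a
    by (metis z order_antisym order_refl to_dhull_le_iff)
  have "inj_on (\<lambda>H. to_dhull -` H) (Prin :: 'a dhull set set)"
  proof (rule inj_onI)
    fix H K :: "'a dhull set"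
    assume "H \<in> Prin" "K \<in> Prin" and eq: "to_dhull -` H = to_dhull -` K"
    then have "H \<in> range conv_gen" "K \<in> range conv_gen" by (auto simp: Prin_def)
    then obtain a b where H: "H = conv_gen (to_dhull a)" and K: "K = conv_gen (to_dhull b)"
      by (meson Prin_dhull)
    have "to_dhull a \<in> K" "to_dhull b \<in> H"
      using eq H K conv_gen_self by blast+
    then show "H = K" using H K by (simp add: conv_gen_least convex_subgroup_conv_gen antisym)
  qed
  moreover have "(\<lambda>H. to_dhull -` H) ` Prin = (Prin :: 'a set set)"
  proof (rule antisym; rule subsetI)
    fix G :: "'a set" assume "G \<in> (\<lambda>H. to_dhull -` H) ` Prin"
    then obtain H where H: "H \<in> range conv_gen" "H \<noteq> {0}" "G = to_dhull -` H"
      by (auto simp: Prin_def)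
    then obtain a where "H = conv_gen (to_dhull a)" by (meson Prin_dhull)
    with H have "G = conv_gen a" "conv_gen (to_dhull a) \<noteq> {0}"
      by (simp_all add: vimage_conv_gen)
    then show "G \<in> Prin" by (auto simp: Prin_def conv_gen_eq_zero_iff inj0)
  next
    fix G :: "'a set" assume "G \<in> Prin"
    then obtain a where a: "G = conv_gen a" "a \<noteq> 0" by (rule PrinE)
    then have "conv_gen (to_dhull a) \<in> Prin"
      by (simp add: Prin_def conv_gen_eq_zero_iff inj0)
    moreover have "G = to_dhull -` conv_gen (to_dhull a)"
      by (simp add: a vimage_conv_gen)
    ultimately show "G \<in> (\<lambda>H. to_dhull -` H) ` Prin" by (rule rev_image_eqI)
  qed
  ultimately show ?thesis by (simp add: bij_betw_def)
qed

definition prin_less :: "'a::linordered_ab_group_add set \<Rightarrow> 'a set \<Rightarrow> bool" where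
  "prin_less i j \<longleftrightarrow> j \<subset> i"

definition hstar :: "'a::linordered_ab_group_add set \<Rightarrow> 'a set" where
  "hstar H = (GREATEST K. convex_subgroup K \<and> K \<subset> H)"

lemma hstar_greatest:
  assumes "i \<in> Prin"
  shows "convex_subgroup (hstar i)" "hstar i \<subset> i"
    "convex_subgroup L \<Longrightarrow> L \<subset> i \<Longrightarrow> L \<subseteq> hstar i"
proof -
  obtain x where x: "i = conv_gen x" "x \<noteq> 0"
    using assms by (rule PrinE)
  let ?C = "{K. convex_subgroup K \<and> K \<subset> i}"
  have sub: "convex_subgroup K \<Longrightarrow> K \<subseteq> i \<Longrightarrow> K \<subset> i \<longleftrightarrow> x \<notin> K" for K
    using x conv_gen_least conv_gen_self by blast
  have "convex_subgroup {0 :: 'a}"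
    by (simp add: convex_subgroup_def)
  moreover have "{0} \<subseteq> i"
    using x convex_subgroup_conv_gen[of x] by (simp add: convex_subgroup_def)
  ultimately have "{0} \<in> ?C" using sub x by simp
  then have 0: "0 \<in> \<Union>?C" by blast
  have plus: "y + z \<in> \<Union>?C" if yz: "y \<in> \<Union>?C" "z \<in> \<Union>?C" for y z
  proof -
    obtain K where K: "K \<in> ?C" "y \<in> K" using yz(1) by (rule UnionE)
    obtain L where L: "L \<in> ?C" "z \<in> L" using yz(2) by (rule UnionE)
    have "K \<subseteq> L \<or> L \<subseteq> K" using K L by (intro convex_subgroup_linear) auto
    then obtain M where M: "M \<in> ?C" "y \<in> M" "z \<in> M" using K L by blast
    then have "y + z \<in> M" by (simp add: convex_subgroup_def)
    with M(1) show ?thesis by (rule UnionI)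
  qed
  have minus: "- y \<in> \<Union>?C" if y: "y \<in> \<Union>?C" for y
  proof -
    obtain K where K: "K \<in> ?C" "y \<in> K" using y by (rule UnionE)
    then have "- y \<in> K" by (simp add: convex_subgroup_def)
    with K(1) show ?thesis by (rule UnionI)
  qed
  have convex: "z \<in> \<Union>?C" if y: "y \<in> \<Union>?C" and z: "gabs z \<le> gabs y" for y z
  proof -
    obtain K where K: "K \<in> ?C" "y \<in> K" using y by (rule UnionE)
    then have "\<forall>\<gamma>\<in>K. \<forall>\<rho>. gabs \<rho> \<le> gabs \<gamma> \<longrightarrow> \<rho> \<in> K"
      by (simp add: convex_subgroup_def)
    with K(2) z have "z \<in> K" by simp
    with K(1) show ?thesis by (rule UnionI)
  qed
  have conv: "convex_subgroup (\<Union>?C)"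
    unfolding convex_subgroup_def[of "\<Union>?C"] 
    by (intro conjI ballI allI impI) (rule 0 | rule plus minus convex; assumption)+
  have "x \<notin> \<Union>?C"
  proof
    assume "x \<in> \<Union>?C"
    then obtain K where "K \<in> ?C" "x \<in> K" by (rule UnionE)
    then show False using sub[of K] by auto
  qed
  moreover have "\<Union>?C \<subseteq> i" by auto
  ultimately have "\<Union>?C \<subset> i" using sub[OF conv] by blast
  then have "hstar i = \<Union>?C"
    unfolding hstar_def by (intro Greatest_equality) (use conv in auto)
  then show "convex_subgroup (hstar i)" "hstar i \<subset> i"
    "convex_subgroup L \<Longrightarrow> L \<subset> i \<Longrightarrow> L \<subseteq> hstar i"
    using conv \<open>\<Union>?C \<subset> i\<close> by auto
qed

text \<open>Cosets are added by the Minkowski sum of sets.\<close>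

definition Qgrp :: "'a::linordered_ab_group_add set \<Rightarrow> 'a set set" where
  "Qgrp i = (\<lambda>x. x +o hstar i) ` i"

definition coset_less :: "'a::linordered_ab_group_add set \<Rightarrow> 'a set \<Rightarrow> bool" where
  "coset_less A B \<longleftrightarrow> A \<noteq> B \<and> (\<exists>a\<in>A. \<exists>b\<in>B. a \<le> b)"

definition Q_embedding :: "'a::linordered_ab_group_add set \<Rightarrow> ('a set \<Rightarrow> real) \<Rightarrow> bool" where
  "Q_embedding i f \<longleftrightarrow>
     (\<forall>A\<in>Qgrp i. \<forall>B\<in>Qgrp i. f (A + B) = f A + f B \<and> (coset_less A B \<longrightarrow> f A < f B))"


section \<open>Hahn products\<close>

text \<open>Elements of the Hahn product of the groups \<open>G j\<close>, \<open>j \<in> J\<close>, with neutral elements \<open>z j\<close>, are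
  represented by functions that take the value \<open>z j\<close> outside \<open>J\<close>. Hence extension by zero is the
  identity, and the Hahn product for \<open>J \<subseteq> J'\<close> is literally contained in the one for \<open>J'\<close>.\<close>

definition hahn_product :: "('j \<Rightarrow> 'j \<Rightarrow> bool) \<Rightarrow> 'j set \<Rightarrow> ('j \<Rightarrow> 'g set) \<Rightarrow> ('j \<Rightarrow> 'g) \<Rightarrow> ('j \<Rightarrow> 'g) set" where
  "hahn_product lt J G z =
     {f. (\<forall>j\<in>J. f j \<in> G j) \<and> (\<forall>j. j \<notin> J \<longrightarrow> f j = z j) \<and>
         (let A = {j \<in> J. f j \<noteq> z j} in
            well_order_on A {(j, k). j \<in> A \<and> k \<in> A \<and> (j = k \<or> lt j k)})}"

definition lex_less ::
    "('j \<Rightarrow> 'j \<Rightarrow> bool) \<Rightarrow> 'j set \<Rightarrow> ('g \<Rightarrow> 'g \<Rightarrow> bool) \<Rightarrow> ('j \<Rightarrow> 'g) \<Rightarrow> ('j \<Rightarrow> 'g) \<Rightarrow> bool" where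
  "lex_less lt J gl f g \<longleftrightarrow> (\<exists>j\<in>J. gl (f j) (g j) \<and> (\<forall>k\<in>J. lt k j \<longrightarrow> f k = g k))"

definition immediate_embedding ::
    "('a::linordered_ab_group_add \<Rightarrow> 'a set \<Rightarrow> 'a set) \<Rightarrow> bool" where
  "immediate_embedding h \<longleftrightarrow>
     range h \<subseteq> hahn_product prin_less Prin Qgrp hstar \<and>
     (\<forall>x y. \<forall>i\<in>Prin. h (x + y) i = h x i + h y i) \<and>
     (\<forall>x y. x < y \<longrightarrow> lex_less prin_less Prin coset_less (h x) (h y)) \<and>
     (\<forall>i\<in>Prin. \<forall>x. conv_gen x = i \<longrightarrow>
        (\<forall>j\<in>Prin. prin_less j i \<longrightarrow> h x j = hstar j) \<and> h x i = x +o hstar i)"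


section \<open>The completed index set\<close>

definition Init :: "('i \<Rightarrow> 'i \<Rightarrow> bool) \<Rightarrow> 'i set \<Rightarrow> 'i set set" where
  "Init lt I = {S. S \<subseteq> I \<and> (\<forall>s\<in>S. \<forall>i\<in>I. lt i s \<longrightarrow> i \<in> S)}"

text \<open>\<open>Cut S\<close> is the added element \<open>i\<^sub>S\<close>.\<close>

datatype 'i cut_index = Elem 'i | Cut "'i set"

fun index_less :: "('i \<Rightarrow> 'i \<Rightarrow> bool) \<Rightarrow> 'i cut_index \<Rightarrow> 'i cut_index \<Rightarrow> bool" where
  "index_less lt (Elem i) (Elem j) \<longleftrightarrow> lt i j"
| "index_less lt (Elem i) (Cut S) \<longleftrightarrow> i \<in> S"
| "index_less lt (Cut S) (Elem i) \<longleftrightarrow> i \<notin> S"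
| "index_less lt (Cut S) (Cut T) \<longleftrightarrow> S \<subset> T"

type_synonym 'a hahn = "'a set cut_index \<Rightarrow> real"

definition II :: "'a::linordered_ab_group_add set cut_index set" where
  "II = Elem ` Prin \<union> Cut ` Init prin_less Prin"

lemma prin_less_total: "i \<in> Prin \<Longrightarrow> j \<in> Prin \<Longrightarrow> prin_less i j \<or> i = j \<or> prin_less j i"
proof -
  assume "i \<in> Prin" "j \<in> Prin"
  then have "convex_subgroup i" "convex_subgroup j"
    by (metis PrinE convex_subgroup_conv_gen)+
  then show ?thesis using convex_subgroup_linear[of i j] by (auto simp: prin_less_def)
qed

lemma Init_linear:
  assumes "S \<in> Init prin_less Prin" "T \<in> Init prin_less Prin"
  shows "S \<subseteq> T \<or> T \<subseteq> S"
proof (rule ccontr)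
  assume "\<not> ?thesis"
  then obtain s t where "s \<in> S" "s \<notin> T" "t \<in> T" "t \<notin> S" by blast
  moreover from this have "prin_less s t \<or> s = t \<or> prin_less t s"
    using assms by (intro prin_less_total) (auto simp: Init_def)
  ultimately show False using assms unfolding Init_def by blast
qed

lemma index_less_irrefl: "\<not> index_less prin_less i i"
  by (cases i) (auto simp: prin_less_def)

lemma index_less_trans:
  assumes "i \<in> II" "j \<in> II" "k \<in> II" "index_less prin_less i j" "index_less prin_less j k"
  shows "index_less prin_less i k"
proof -
  have cut: "prin_less p q" if "p \<in> S" "q \<notin> S" "S \<in> Init prin_less Prin" "q \<in> Prin" for p q S
    using that prin_less_total[of p q] by (auto simp: Init_def)
  have up: "p \<in> S" if "prin_less p q" "q \<in> S" "S \<in> Init prin_less Prin" "p \<in> Prin" for p q S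
    using that by (auto simp: Init_def)
  have elem: "p \<in> Prin" if "Elem p \<in> II" for p using that by (auto simp: II_def)
  have init: "S \<in> Init prin_less Prin" if "Cut S \<in> II" for S using that by (auto simp: II_def)
  have between: "S \<subset> T" if "p \<notin> S" "p \<in> T" "S \<in> Init prin_less Prin" "T \<in> Init prin_less Prin" for p S T
    using that Init_linear[of S T] by blast
  have tr: "prin_less p r" if "prin_less p q" "prin_less q r" for p q r :: "'a set"
    using that by (auto simp: prin_less_def)
  show ?thesis
  proof (cases j)
    case (Elem q)
    show ?thesis
      using assms(4,5) elem init assms(1-3) unfolding Elem
      by (cases i; cases k) (auto intro: tr up dest: between)
  next
    case (Cut S)
    show ?thesis
      using assms(4,5) elem init assms(1-3) unfolding Cut
      by (cases i; cases k) (auto intro: cut)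
  qed
qed

lemma index_less_total:
  assumes "i \<in> II" "j \<in> II"
  shows "index_less prin_less i j \<or> i = j \<or> index_less prin_less j i"
  using assms by (cases i; cases j) (auto simp: II_def dest: prin_less_total Init_linear)

definition Rlex :: "'a::linordered_ab_group_add set cut_index set \<Rightarrow> 'a hahn set" where
  "Rlex J = hahn_product (index_less prin_less) J (\<lambda>_. UNIV) (\<lambda>_. 0)"

definition Rlex_less :: "'a::linordered_ab_group_add hahn \<Rightarrow> 'a hahn \<Rightarrow> bool" where
  "Rlex_less = lex_less (index_less prin_less) II (<)"


section \<open>The small-extensions closure\<close>

text \<open>In this section \<open>\<phi> i\<close> is the chosen embedding of \<open>Q\<^sub>i\<close> into \<open>\<real>\<close>, and \<open>h\<close> is the chosen
  immediate embedding of \<open>\<Gamma>\<^sub>\<rat>\<close>, which is the type \<open>'a dhull\<close> for \<open>\<Gamma> = 'a\<close>.\<close>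

definition GammaQ ::
    "('a::linordered_ab_group_add dhull set \<Rightarrow> 'a dhull set \<Rightarrow> real) \<Rightarrow>
     ('a dhull \<Rightarrow> 'a dhull set \<Rightarrow> 'a dhull set) \<Rightarrow> 'a dhull hahn set" where
  "GammaQ \<phi> h =
     range (\<lambda>x j. case j of Elem i \<Rightarrow> if i \<in> Prin then \<phi> i (h x i) else 0 | Cut S \<Rightarrow> 0)"

definition restr :: "'a::linordered_ab_group_add set set \<Rightarrow> 'a hahn \<Rightarrow> 'a hahn" where
  "restr S \<beta> = (\<lambda>j. if j \<in> Elem ` S then \<beta> j else 0)"

definition commensurable where
  "commensurable \<phi> h S \<rho> \<longleftrightarrow> (\<exists>b\<in>GammaQ \<phi> h. \<rho> = restr S b)"

definition EqRk where
  "EqRk \<phi> h =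
     {\<beta> \<in> Rlex (Elem ` Prin).
        \<exists>S\<in>Init prin_less Prin.
          \<not> commensurable \<phi> h S (restr S \<beta>) \<and>
          (\<forall>T\<in>Init prin_less Prin. \<not> commensurable \<phi> h T (restr T \<beta>) \<longrightarrow> S \<subseteq> T) \<and>
          \<beta> = restr S \<beta>}"

definition IncRk where
  "IncRk \<phi> h =
     (\<Union>S\<in>Init prin_less Prin. \<Union>b\<in>{b \<in> Rlex (Elem ` S). commensurable \<phi> h S b}.
        {b(Cut S := 1), b(Cut S := - 1)})"

definition GammaR where
  "GammaR \<phi> h = GammaQ \<phi> h \<union> EqRk \<phi> h"

definition GammaSme where
  "GammaSme \<phi> h = GammaR \<phi> h \<union> IncRk \<phi> h"

end

theory Submission
  imports Defs
begin

text \<open>Let \<open>\<alpha> < x < \<beta>\<close>, where \<open>\<alpha>\<close> and \<open>x\<close> first differ at the index \<open>j\<close> and \<open>x\<close> and \<open>\<beta>\<close> at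
  \<open>k\<close>. Rational multiples of a generator of \<open>s \<in> I\<close> show that an element of \<open>\<Gamma>\<^sub>\<rat>\<close> can be changed
  at the coordinate \<open>s\<close> to a value in any given open interval, without changing its coordinates
  below \<open>s\<close>. So it suffices to find \<open>s \<ge> j, k\<close> such that \<open>x\<close> agrees with an element of \<open>\<Gamma>\<^sub>\<rat>\<close> below
  \<open>s\<close>. If \<open>x\<close> is a minimal incommensurable element, with initial segment \<open>S\<close>, then an element of
  \<open>\<Gamma>\<^sub>s\<^sub>m\<^sub>e\<close> that agrees with \<open>x\<close> on \<open>S\<close> is equal to \<open>x\<close>, hence some \<open>s \<in> S\<close> will do. If
  \<open>x = (b|\<plusminus>1|0)\<close>, then \<open>j, k \<le> i\<^sub>S\<close> for the same reason, and \<open>j = k = i\<^sub>S\<close> is impossible because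
  there is no room for \<open>\<plusminus>1\<close> strictly between two values in \<open>{-1, 0, 1}\<close>. When exactly one of \<open>j, k\<close>
  is \<open>i\<^sub>S\<close>, one moves away from \<open>b\<close> towards the other side.\<close>

section \<open>Coordinates of elements of \<open>GammaQ\<close>, and changing one of them\<close>

definition hahn_map ::
    "('a::linordered_ab_group_add dhull set \<Rightarrow> 'a dhull set \<Rightarrow> real) \<Rightarrow>
     ('a dhull \<Rightarrow> 'a dhull set \<Rightarrow> 'a dhull set) \<Rightarrow> 'a dhull \<Rightarrow> 'a dhull hahn" where
  "hahn_map \<phi> h x =
     (\<lambda>j. case j of Elem i \<Rightarrow> if i \<in> Prin then \<phi> i (h x i) else 0 | Cut S \<Rightarrow> 0)"

lemma GammaQ_eq_range: "GammaQ \<phi> h = range (hahn_map \<phi> h)"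
  by (simp add: GammaQ_def hahn_map_def[abs_def])

lemma hahn_map_Cut [simp]: "hahn_map \<phi> h x (Cut S) = 0"
  by (simp add: hahn_map_def)

lemma prin_less_trans: "prin_less i j \<Longrightarrow> prin_less j k \<Longrightarrow> prin_less i k"
  by (auto simp: prin_less_def)

lemma below_in_Init: "{p \<in> Prin. prin_less p s} \<in> Init prin_less Prin"
  by (auto simp: Init_def intro: prin_less_trans)

lemma nsmul_two: "nsmul 2 c = c + c"
  by (simp add: numeral_2_eq_2)

lemma immediate_embeddingD:
  assumes "immediate_embedding h"
  shows "range h \<subseteq> hahn_product prin_less Prin Qgrp hstar"
    and "i \<in> Prin \<Longrightarrow> h (x + y) i = h x i + h y i"
    and "i \<in> Prin \<Longrightarrow> conv_gen x = i \<Longrightarrow> j \<in> Prin \<Longrightarrow> prin_less j i \<Longrightarrow> h x j = hstar j"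
    and "i \<in> Prin \<Longrightarrow> conv_gen x = i \<Longrightarrow> h x i = x +o hstar i"
  using assms unfolding immediate_embedding_def by (elim conjE; simp)+

lemma Q_embeddingD:
  assumes "Q_embedding i f" "A \<in> Qgrp i" "B \<in> Qgrp i"
  shows "f (A + B) = f A + f B" and "coset_less A B \<Longrightarrow> f A < f B"
  using assms unfolding Q_embedding_def by auto

context
  fixes \<phi> :: "'a::linordered_ab_group_add dhull set \<Rightarrow> 'a dhull set \<Rightarrow> real"
    and h :: "'a dhull \<Rightarrow> 'a dhull set \<Rightarrow> 'a dhull set"
  assumes Q_emb: "\<And>i. i \<in> Prin \<Longrightarrow> Q_embedding i (\<phi> i)"
    and imm: "immediate_embedding h"
begin

lemma h_in_Qgrp: "i \<in> Prin \<Longrightarrow> h x i \<in> Qgrp i"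
proof -
  assume i: "i \<in> Prin"
  have "h x \<in> hahn_product prin_less Prin Qgrp hstar"
    by (rule subsetD[OF immediate_embeddingD(1)[OF imm] rangeI])
  then show ?thesis using i by (simp add: hahn_product_def)
qed

lemma hahn_map_add: "hahn_map \<phi> h (x + y) j = hahn_map \<phi> h x j + hahn_map \<phi> h y j"
proof (cases j)
  case (Elem i)
  show ?thesis
  proof (cases "i \<in> Prin")
    case True
    have "h (x + y) i = h x i + h y i"
      by (rule immediate_embeddingD(2)[OF imm True])
    moreover have "\<phi> i (h x i + h y i) = \<phi> i (h x i) + \<phi> i (h y i)"
      by (rule Q_embeddingD(1)[OF Q_emb[OF True] h_in_Qgrp[OF True] h_in_Qgrp[OF True]])
    ultimately show ?thesis by (simp add: Elem hahn_map_def)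
  qed (simp add: Elem hahn_map_def)
qed simp

lemma hahn_map_zero: "hahn_map \<phi> h 0 j = 0"
  using hahn_map_add[of 0 0 j] by simp

lemma hahn_map_minus: "hahn_map \<phi> h (- x) j = - hahn_map \<phi> h x j"
  using hahn_map_add[of x "- x" j] by (simp add: hahn_map_zero)

lemma hahn_map_nsmul: "hahn_map \<phi> h (nsmul n x) j = of_nat n * hahn_map \<phi> h x j"
  by (induction n) (simp_all add: hahn_map_zero hahn_map_add algebra_simps)

text \<open>For a fraction a/n, divisibility of the hull gives an n-th part of \<open>x\<close>; the
  multiple of it by a has the required coordinates, because \<open>hahn_map\<close> is
  additive.\<close>

lemma hahn_map_rational_multiple:
  assumes "t \<in> \<rat>"
  obtains y where "\<And>j. hahn_map \<phi> h y j = t * hahn_map \<phi> h x j"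
proof -
  obtain a :: int and n :: int where t: "t = of_int a / of_int n" "n > 0"
    using assms by (auto elim: Rats_cases')
  obtain y where y: "nsmul (nat n) y = x"
    using dhull_divisible[of "nat n" x] t by auto
  have n: "hahn_map \<phi> h x j = of_int n * hahn_map \<phi> h y j" for j
    using hahn_map_nsmul[of "nat n" y j] t by (simp add: y)
  define z where "z = (if a \<ge> 0 then nsmul (nat a) y else - nsmul (nat (- a)) y)"
  have "hahn_map \<phi> h z j = t * hahn_map \<phi> h x j" for j
    using t by (simp add: z_def hahn_map_minus hahn_map_nsmul n)
  then show thesis by (rule that)
qed

text \<open>A generator \<open>c\<close> of \<open>s\<close> works, by comparison with
  \<open>c + c\<close>, which generates the same \<open>s\<close>. At \<open>p\<close> before
  \<open>s\<close> both have the coset \<open>hstar p\<close>, so the real coordinate v of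
  \<open>c\<close> satisfies v = 2v. At \<open>s\<close> the two cosets are different, hence
  strictly ordered, and strict monotonicity of the embedding excludes v = 2v.\<close>

lemma hahn_map_generator:
  assumes s: "s \<in> Prin"
  obtains c where "\<And>p. p \<in> Prin \<Longrightarrow> prin_less p s \<Longrightarrow> hahn_map \<phi> h c (Elem p) = 0"
    and "hahn_map \<phi> h c (Elem s) \<noteq> 0"
proof -
  obtain c where c: "s = conv_gen c" "c \<noteq> 0" using s by (rule PrinE)
  have c2: "conv_gen (c + c) = s"
    using conv_gen_nsmul[of 2 c] c by (simp add: nsmul_two)
  have double: "hahn_map \<phi> h (c + c) j = 2 * hahn_map \<phi> h c j" for j
    by (simp add: hahn_map_add)
  note lead = immediate_embeddingD(3,4)[OF imm s]
  have "hahn_map \<phi> h c (Elem p) = 0" if p: "p \<in> Prin" "prin_less p s" for p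
  proof -
    have "h (c + c) p = h c p" using lead(1)[OF _ p] c c2 by simp
    then have "hahn_map \<phi> h (c + c) (Elem p) = hahn_map \<phi> h c (Elem p)"
      by (simp add: hahn_map_def)
    then show ?thesis using double[of "Elem p"] by simp
  qed
  moreover have "hahn_map \<phi> h c (Elem s) \<noteq> 0"
  proof
    assume 0: "hahn_map \<phi> h c (Elem s) = 0"
    have eq: "\<phi> s (h (c + c) s) = \<phi> s (h c s)"
      using 0 double[of "Elem s"] s by (simp add: hahn_map_def)
    have zero: "0 \<in> hstar s"
      using hstar_greatest(1)[OF s] by (simp add: convex_subgroup_def)
    \<comment> \<open>Otherwise \<open>hstar s\<close> would contain \<open>conv_gen c\<close>,
      which is \<open>s\<close>, although it is a proper subset of \<open>s\<close>.\<close>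
    have cnot: "c \<notin> hstar s"
      using hstar_greatest(1,2)[OF s] conv_gen_least[of "hstar s" c] c by blast
    have neq: "c +o hstar s \<noteq> (c + c) +o hstar s"
    proof
      assume "c +o hstar s = (c + c) +o hstar s"
      moreover have "c + c \<in> (c + c) +o hstar s" using zero by (force simp: elt_set_plus_def)
      ultimately have "c + c \<in> c +o hstar s" by simp
      then show False using cnot by (auto simp: elt_set_plus_def)
    qed
    have mem: "c \<in> c +o hstar s" "c + c \<in> (c + c) +o hstar s"
      using zero by (force simp: elt_set_plus_def)+
    have mono: "\<phi> s A < \<phi> s B" if "A \<in> Qgrp s" "B \<in> Qgrp s" "coset_less A B" for A B
      by (rule Q_embeddingD(2)[OF Q_emb[OF s] that])
    have hc: "h c s = c +o hstar s" "h (c + c) s = (c + c) +o hstar s"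
      using lead(2) c(1) c2 by metis+
    \<comment> \<open>The sign of \<open>c\<close> is unknown, so the two cosets may be ordered
      either way; both orders contradict the equality of the values.\<close>
    have "c \<le> c + c \<or> c + c \<le> c" by (rule linear)
    then have "coset_less (h c s) (h (c + c) s) \<or> coset_less (h (c + c) s) (h c s)"
      unfolding coset_less_def hc using neq mem by metis
    then show False using mono h_in_Qgrp[OF s] eq by (metis less_irrefl)
  qed
  ultimately show thesis by (rule that)
qed

text \<open>Add to \<open>b\<close> a rational multiple of a generator of \<open>s\<close>. It
  vanishes at all indices below \<open>s\<close>, and its coordinate at \<open>s\<close> runs
  through the rational multiples of a non-zero real, which are dense.\<close>

lemma interpolate_coordinate:
  assumes s: "s \<in> Prin" and "l < u"
  obtains y where "l < hahn_map \<phi> h y (Elem s)" "hahn_map \<phi> h y (Elem s) < u"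
    and "\<And>j. j \<in> II \<Longrightarrow> index_less prin_less j (Elem s) \<Longrightarrow> hahn_map \<phi> h y j = hahn_map \<phi> h b j"
proof -
  obtain c where c: "\<And>p. p \<in> Prin \<Longrightarrow> prin_less p s \<Longrightarrow> hahn_map \<phi> h c (Elem p) = 0"
    "hahn_map \<phi> h c (Elem s) \<noteq> 0"
    using hahn_map_generator[OF s] by blast
  define r where "r = hahn_map \<phi> h c (Elem s)"
  define B where "B = hahn_map \<phi> h b (Elem s)"
  have r: "r \<noteq> 0" using c by (simp add: r_def)
  have "\<exists>t\<in>\<rat>. l - B < t * r \<and> t * r < u - B"
  proof (cases "r > 0")
    case True
    then have "(l - B) / r < (u - B) / r" using \<open>l < u\<close> by (simp add: divide_strict_right_mono)
    then obtain t where "t \<in> \<rat>" "(l - B) / r < t" "t < (u - B) / r"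
      using Rats_dense_in_real by blast
    then show ?thesis using True by (auto simp: field_simps)
  next
    case False
    then have "r < 0" using r by simp
    then have "(u - B) / r < (l - B) / r" using \<open>l < u\<close> by (simp add: divide_strict_right_mono_neg)
    then obtain t where "t \<in> \<rat>" "(u - B) / r < t" "t < (l - B) / r"
      using Rats_dense_in_real by blast
    then show ?thesis using \<open>r < 0\<close> by (auto simp: field_simps)
  qed
  then obtain t where t: "t \<in> \<rat>" "l - B < t * r" "t * r < u - B" by blast
  obtain z where z: "\<And>j. hahn_map \<phi> h z j = t * hahn_map \<phi> h c j"
    using hahn_map_rational_multiple[OF t(1)] by blast
  show thesis
  proof (rule that[of "b + z"])
    show "l < hahn_map \<phi> h (b + z) (Elem s)" "hahn_map \<phi> h (b + z) (Elem s) < u"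
      using t by (simp_all add: hahn_map_add z flip: r_def B_def)
    fix j assume "j \<in> II" "index_less prin_less j (Elem s)"
    then show "hahn_map \<phi> h (b + z) j = hahn_map \<phi> h b j"
      by (cases j) (auto simp: hahn_map_add z II_def c(1))
  qed
qed

text \<open>The common last step of all constructions: \<open>low\<close> and \<open>up\<close> say
  that coordinates up to \<open>s\<close> settle both comparisons. The interval from
  \<open>l\<close> to \<open>u\<close> need not contain the coordinate of \<open>x\<close> at
  \<open>s\<close>; it may also have that coordinate as an endpoint.\<close>

lemma GammaQ_between:
  assumes s: "s \<in> Prin" and "l < u"
    and b: "\<And>j. j \<in> II \<Longrightarrow> index_less prin_less j (Elem s) \<Longrightarrow> hahn_map \<phi> h b j = x j"
    and low: "\<And>q. (\<And>j. j \<in> II \<Longrightarrow> index_less prin_less j (Elem s) \<Longrightarrow> q j = x j) \<Longrightarrow>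
                l < q (Elem s) \<Longrightarrow> Rlex_less \<alpha> q"
    and up: "\<And>q. (\<And>j. j \<in> II \<Longrightarrow> index_less prin_less j (Elem s) \<Longrightarrow> q j = x j) \<Longrightarrow>
                q (Elem s) < u \<Longrightarrow> Rlex_less q \<beta>"
  shows "\<exists>q\<in>GammaQ \<phi> h. Rlex_less \<alpha> q \<and> Rlex_less q \<beta>"
proof -
  obtain y where y: "l < hahn_map \<phi> h y (Elem s)" "hahn_map \<phi> h y (Elem s) < u"
    "\<And>j. j \<in> II \<Longrightarrow> index_less prin_less j (Elem s) \<Longrightarrow> hahn_map \<phi> h y j = hahn_map \<phi> h b j"
    using interpolate_coordinate[OF s \<open>l < u\<close>] by blast
  have "Rlex_less \<alpha> (hahn_map \<phi> h y)" using y b by (intro low) auto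
  moreover have "Rlex_less (hahn_map \<phi> h y) \<beta>" using y b by (intro up) auto
  ultimately show ?thesis by (auto simp: GammaQ_eq_range)
qed

end

section \<open>Lexicographic comparison through the first difference\<close>

definition differ_first ::
    "'a::linordered_ab_group_add hahn \<Rightarrow> 'a hahn \<Rightarrow> 'a set cut_index \<Rightarrow> bool" where
  "differ_first f g j \<longleftrightarrow>
     j \<in> II \<and> f j \<noteq> g j \<and> (\<forall>k\<in>II. index_less prin_less k j \<longrightarrow> f k = g k)"

lemma Rlex_less_iff: "Rlex_less f g \<longleftrightarrow> (\<exists>j. differ_first f g j \<and> f j < g j)"
  unfolding Rlex_less_def lex_less_def differ_first_def by fastforce

lemma differ_first_commute: "differ_first f g j \<longleftrightarrow> differ_first g f j"
  by (auto simp: differ_first_def)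

lemma in_II_iff [simp]: "Elem p \<in> II \<longleftrightarrow> p \<in> Prin" "Cut T \<in> II \<longleftrightarrow> T \<in> Init prin_less Prin"
  by (auto simp: II_def)

text \<open>If \<open>j\<close> is below \<open>s\<close>, then \<open>q\<close> copies
  \<open>x\<close> at \<open>j\<close>, so the comparison is already decided there and any number
  below the coordinate of \<open>x\<close> at \<open>s\<close> serves as \<open>l\<close>. If
  \<open>j\<close> is \<open>s\<close> itself, the coordinate of \<alpha> is the bound.\<close>

lemma lower_bound_at:
  assumes j: "differ_first \<alpha> x j" "\<alpha> j < x j"
    and s: "s \<in> Prin" "j = Elem s \<or> index_less prin_less j (Elem s)"
  obtains l where "l < x (Elem s)"
    and "\<And>q. (\<And>j. j \<in> II \<Longrightarrow> index_less prin_less j (Elem s) \<Longrightarrow> q j = x j) \<Longrightarrow>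
           l < q (Elem s) \<Longrightarrow> Rlex_less \<alpha> q"
proof
  let ?l = "if j = Elem s then \<alpha> j else x (Elem s) - 1"
  show "?l < x (Elem s)" using j by auto
  fix q
  assume q: "\<And>j. j \<in> II \<Longrightarrow> index_less prin_less j (Elem s) \<Longrightarrow> q j = x j" "?l < q (Elem s)"
  have "\<alpha> j < q j" using q s j by (auto simp: differ_first_def index_less_irrefl)
  moreover have "\<alpha> k = q k" if k: "k \<in> II" "index_less prin_less k j" for k
  proof -
    have "index_less prin_less k (Elem s)"
      using k s j(1) index_less_trans[of k j "Elem s"] by (auto simp: differ_first_def)
    then show ?thesis using k j(1) q(1) by (simp add: differ_first_def)
  qed
  ultimately show "Rlex_less \<alpha> q"
    using j by (auto simp: Rlex_less_iff differ_first_def)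
qed

lemma upper_bound_at:
  assumes j: "differ_first x \<beta> j" "x j < \<beta> j"
    and s: "s \<in> Prin" "j = Elem s \<or> index_less prin_less j (Elem s)"
  obtains u where "x (Elem s) < u"
    and "\<And>q. (\<And>j. j \<in> II \<Longrightarrow> index_less prin_less j (Elem s) \<Longrightarrow> q j = x j) \<Longrightarrow>
           q (Elem s) < u \<Longrightarrow> Rlex_less q \<beta>"
proof
  let ?u = "if j = Elem s then \<beta> j else x (Elem s) + 1"
  show "x (Elem s) < ?u" using j by auto
  fix q
  assume q: "\<And>j. j \<in> II \<Longrightarrow> index_less prin_less j (Elem s) \<Longrightarrow> q j = x j" "q (Elem s) < ?u"
  have "q j < \<beta> j" using q s j by (auto simp: differ_first_def index_less_irrefl)
  moreover have "q k = \<beta> k" if k: "k \<in> II" "index_less prin_less k j" for k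
  proof -
    have "index_less prin_less k (Elem s)"
      using k s j(1) index_less_trans[of k j "Elem s"] by (auto simp: differ_first_def)
    then show ?thesis using k j(1) q(1) by (simp add: differ_first_def)
  qed
  ultimately show "Rlex_less q \<beta>"
    using j by (auto simp: Rlex_less_iff differ_first_def)
qed

text \<open>The index \<open>j\<close> is either some \<open>Elem s\<close> with \<open>s\<close> in
  \<open>S\<close>, or \<open>Cut T\<close> with \<open>T\<close> properly inside \<open>S\<close>;
  in the latter case any \<open>s\<close> in \<open>S\<close> outside \<open>T\<close> lies above
  it.\<close>

lemma below_Cut:
  assumes "index_less prin_less j (Cut S)"
  obtains s where "s \<in> S" "j = Elem s \<or> index_less prin_less j (Elem s)"
  using assms that by (cases j) auto

text \<open>The later of \<open>s\<close> and \<open>t\<close> in the total order of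
  \<open>Prin\<close> bounds both \<open>j\<close> and \<open>k\<close>.\<close>

lemma max_in_Init:
  assumes S: "S \<in> Init prin_less Prin" and "s \<in> S" "t \<in> S"
    and j: "j \<in> II" "j = Elem s \<or> index_less prin_less j (Elem s)"
    and k: "k \<in> II" "k = Elem t \<or> index_less prin_less k (Elem t)"
  obtains m where "m \<in> S" "j = Elem m \<or> index_less prin_less j (Elem m)"
    "k = Elem m \<or> index_less prin_less k (Elem m)"
proof -
  have P: "s \<in> Prin" "t \<in> Prin" using assms by (auto simp: Init_def)
  consider "s = t" | "prin_less s t" | "prin_less t s" using prin_less_total[OF P] by blast
  then show thesis
  proof cases
    case 1
    then show ?thesis using that[of s] assms by simp
  next
    case 2
    then show ?thesis
      using that[of t] assms P index_less_trans[of j "Elem s" "Elem t"] by auto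
  next
    case 3
    then show ?thesis
      using that[of s] assms P index_less_trans[of k "Elem t" "Elem s"] by auto
  qed
qed

section \<open>The kinds of elements of \<open>GammaSme\<close>, and where they can first
  differ\<close>

lemma IncRkE:
  assumes "\<beta> \<in> IncRk \<phi> h"
  obtains S y e where "S \<in> Init prin_less Prin" "e = 1 \<or> e = - 1"
    "\<beta> = (restr S (hahn_map \<phi> h y))(Cut S := e)"
  using assms unfolding IncRk_def commensurable_def GammaQ_eq_range by blast

lemma EqRkE:
  assumes "\<beta> \<in> EqRk \<phi> h"
  obtains S where "S \<in> Init prin_less Prin" "\<not> commensurable \<phi> h S (restr S \<beta>)"
    "\<And>T. T \<in> Init prin_less Prin \<Longrightarrow> \<not> commensurable \<phi> h T (restr T \<beta>) \<Longrightarrow> S \<subseteq> T"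
    "\<beta> = restr S \<beta>"
  using assms unfolding EqRk_def by blast

lemma restr_Cut [simp]: "restr S f (Cut T) = 0"
  by (auto simp: restr_def)

lemma restr_Elem [simp]: "restr S f (Elem p) = (if p \<in> S then f (Elem p) else 0)"
  by (auto simp: restr_def)

lemma restr_cong: "(\<And>p. p \<in> S \<Longrightarrow> f (Elem p) = g (Elem p)) \<Longrightarrow> restr S f = restr S g"
  by (auto simp: restr_def fun_eq_iff)

lemma EqRk_Cut: "\<beta> \<in> EqRk \<phi> h \<Longrightarrow> \<beta> (Cut T) = 0"
  by (metis EqRkE restr_Cut)

lemma GammaSme_cases:
  assumes "\<alpha> \<in> GammaSme \<phi> h"
  obtains (Q) y where "\<alpha> = hahn_map \<phi> h y" | (E) "\<alpha> \<in> EqRk \<phi> h" | (I) "\<alpha> \<in> IncRk \<phi> h"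
  using assms by (auto simp: GammaSme_def GammaR_def GammaQ_eq_range)

lemma GammaSme_Cut:
  assumes "\<alpha> \<in> GammaSme \<phi> h"
  shows "\<alpha> (Cut T) = 0 \<or> \<alpha> (Cut T) = 1 \<or> \<alpha> (Cut T) = - 1"
  using assms
proof (cases rule: GammaSme_cases)
  case I
  then show ?thesis by (rule IncRkE) auto
qed (simp_all add: EqRk_Cut)

text \<open>An element of \<open>GammaQ\<close> is commensurable on \<open>S\<close>, while \<alpha>
  is not. For \<alpha> in \<open>EqRk\<close>, minimality on both sides forces the two initial
  segments to coincide. For \<alpha> in \<open>IncRk\<close>, its cut would lie properly inside
  \<open>S\<close>, where \<alpha> has the coordinate 1 or -1 and \<open>x\<close> has 0.\<close>

lemma EqRk_determined:
  assumes \<alpha>: "\<alpha> \<in> GammaSme \<phi> h"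
    and S: "S \<in> Init prin_less Prin" "\<not> commensurable \<phi> h S (restr S x)"
      "\<And>T. T \<in> Init prin_less Prin \<Longrightarrow> \<not> commensurable \<phi> h T (restr T x) \<Longrightarrow> S \<subseteq> T"
      "x = restr S x"
    and elem: "\<And>p. p \<in> S \<Longrightarrow> \<alpha> (Elem p) = x (Elem p)"
    and cut: "\<And>T. T \<in> Init prin_less Prin \<Longrightarrow> T \<subset> S \<Longrightarrow> \<alpha> (Cut T) = x (Cut T)"
  shows "\<alpha> = x"
proof -
  have eq: "restr T \<alpha> = restr T x" if "T \<subseteq> S" for T
    using that elem by (intro restr_cong) auto
  have inc: "\<not> commensurable \<phi> h S (restr S \<alpha>)" using eq[of S] S(2) by simp
  from \<alpha> show ?thesis
  proof (cases rule: GammaSme_cases)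
    case (Q y)
    then show ?thesis using inc by (auto simp: commensurable_def GammaQ_eq_range)
  next
    case E
    then obtain T where T: "T \<in> Init prin_less Prin" "\<not> commensurable \<phi> h T (restr T \<alpha>)"
      "\<And>T'. T' \<in> Init prin_less Prin \<Longrightarrow> \<not> commensurable \<phi> h T' (restr T' \<alpha>) \<Longrightarrow> T \<subseteq> T'"
      "\<alpha> = restr T \<alpha>" by (rule EqRkE) blast
    have "T \<subseteq> S" using T(3) S(1) inc by blast
    moreover from this have "S \<subseteq> T" using S(3)[OF T(1)] T(2) eq by simp
    ultimately show ?thesis using T(4) S(4) eq by simp
  next
    case I
    then obtain T y e where T: "T \<in> Init prin_less Prin" "e = 1 \<or> e = - 1"
      "\<alpha> = (restr T (hahn_map \<phi> h y))(Cut T := e)" by (rule IncRkE)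
    have "\<not> S \<subseteq> T"
    proof
      assume "S \<subseteq> T"
      then have "restr S \<alpha> = restr S (hahn_map \<phi> h y)" using T(3) by (intro restr_cong) auto
      then show False using inc by (auto simp: commensurable_def GammaQ_eq_range)
    qed
    then have "T \<subset> S" using Init_linear[OF S(1) T(1)] by blast
    then have "\<alpha> (Cut T) = x (Cut T)" using cut T(1) by blast
    moreover have "x (Cut T) = 0" by (metis S(4) restr_Cut)
    ultimately show ?thesis using T by auto
  qed
qed

lemma EqRk_differ_first:
  assumes \<alpha>: "\<alpha> \<in> GammaSme \<phi> h" and j: "differ_first \<alpha> x j"
    and S: "S \<in> Init prin_less Prin" "\<not> commensurable \<phi> h S (restr S x)"
      "\<And>T. T \<in> Init prin_less Prin \<Longrightarrow> \<not> commensurable \<phi> h T (restr T x) \<Longrightarrow> S \<subseteq> T"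
      "x = restr S x"
  obtains s where "s \<in> S" "j = Elem s \<or> index_less prin_less j (Elem s)"
proof (rule ccontr)
  assume "\<not> thesis"
  then have none: "\<forall>s\<in>S. \<not> (j = Elem s \<or> index_less prin_less j (Elem s))"
    using that by blast
  have SP: "s \<in> Prin" if "s \<in> S" for s using that S(1) by (auto simp: Init_def)
  have less: "index_less prin_less (Elem s) j" if "s \<in> S" for s
    using none that index_less_total[of j "Elem s"] SP[OF that] j by (auto simp: differ_first_def)
  have "\<alpha> = x"
  proof (rule EqRk_determined[OF \<alpha> S])
    show "\<alpha> (Elem p) = x (Elem p)" if "p \<in> S" for p
      using j less[OF that] SP[OF that] by (simp add: differ_first_def)
    fix T assume T: "T \<in> Init prin_less Prin" "T \<subset> S"
    then obtain s where s: "s \<in> S" "s \<notin> T" by blast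
    \<comment> \<open>The element \<open>s\<close> lies between: \<open>Cut T\<close> is below
      \<open>Elem s\<close>, which is below \<open>j\<close>.\<close>
    have "index_less prin_less (Cut T) j"
      using index_less_trans[of "Cut T" "Elem s" j] T s SP less j by (auto simp: differ_first_def)
    then show "\<alpha> (Cut T) = x (Cut T)" using j T by (simp add: differ_first_def)
  qed
  then show False using j by (simp add: differ_first_def)
qed

text \<open>If the first difference came after \<open>Cut S\<close>, then \<alpha> would have the
  non-zero coordinate \<open>e\<close> at \<open>Cut S\<close>. This is possible only in
  \<open>IncRk\<close> with the same cut and sign, and agreement on \<open>S\<close> then makes
  \<alpha> equal to \<open>x\<close>.\<close>

lemma IncRk_differ_first:
  assumes \<alpha>: "\<alpha> \<in> GammaSme \<phi> h" and j: "differ_first \<alpha> x j"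
    and S: "S \<in> Init prin_less Prin" and e: "e = 1 \<or> e = - 1"
    and x: "x = (restr S b)(Cut S := e)"
  shows "j = Cut S \<or> index_less prin_less j (Cut S)"
proof (rule ccontr)
  assume "\<not> ?thesis"
  then have less: "index_less prin_less (Cut S) j"
    using index_less_total[of j "Cut S"] j S by (auto simp: differ_first_def)
  then have cut: "\<alpha> (Cut S) = e" using j S by (simp add: differ_first_def x)
  have elem: "\<alpha> (Elem p) = b (Elem p)" if p: "p \<in> S" for p
  proof -
    have P: "p \<in> Prin" using p S by (auto simp: Init_def)
    then have "index_less prin_less (Elem p) j"
      using index_less_trans[of "Elem p" "Cut S" j] p S less j by (auto simp: differ_first_def)
    then show ?thesis using j P p by (simp add: differ_first_def x)
  qed
  from \<alpha> have "\<alpha> = x"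
  proof (cases rule: GammaSme_cases)
    case I
    then obtain T y e' where T: "T \<in> Init prin_less Prin" "e' = 1 \<or> e' = - 1"
      "\<alpha> = (restr T (hahn_map \<phi> h y))(Cut T := e')" by (rule IncRkE)
    \<comment> \<open>\<open>restr\<close> vanishes at every cut, so the only non-zero cut
      coordinate of \<alpha> is the one at \<open>Cut T\<close>.\<close>
    have "T = S" "e' = e" using cut e T(3) by (auto split: if_splits)
    moreover have "restr S (hahn_map \<phi> h y) = restr S b"
      using elem \<open>T = S\<close> T(3) by (intro restr_cong) auto
    ultimately show ?thesis using T(3) x by simp
  qed (use cut e in \<open>auto simp: EqRk_Cut\<close>)
  then show False using j by (simp add: differ_first_def)
qed

section \<open>Replacing an intermediate element by one of \<open>GammaQ\<close>\<close>

lemma between_EqRk: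
  assumes Q: "\<And>i. i \<in> Prin \<Longrightarrow> Q_embedding i (\<phi> i)" "immediate_embedding h"
    and \<alpha>: "\<alpha> \<in> GammaSme \<phi> h" "Rlex_less \<alpha> x"
    and \<beta>: "\<beta> \<in> GammaSme \<phi> h" "Rlex_less x \<beta>"
    and x: "x \<in> EqRk \<phi> h"
  shows "\<exists>q\<in>GammaQ \<phi> h. Rlex_less \<alpha> q \<and> Rlex_less q \<beta>"
proof -
  obtain j where j: "differ_first \<alpha> x j" "\<alpha> j < x j" using \<alpha> by (auto simp: Rlex_less_iff)
  obtain k where k: "differ_first x \<beta> k" "x k < \<beta> k" using \<beta> by (auto simp: Rlex_less_iff)
  obtain S where S: "S \<in> Init prin_less Prin" "\<not> commensurable \<phi> h S (restr S x)"
    "\<And>T. T \<in> Init prin_less Prin \<Longrightarrow> \<not> commensurable \<phi> h T (restr T x) \<Longrightarrow> S \<subseteq> T"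
    "x = restr S x" using x by (rule EqRkE) blast
  obtain s where s: "s \<in> S" "j = Elem s \<or> index_less prin_less j (Elem s)"
    using EqRk_differ_first[OF \<alpha>(1) j(1) S] by blast
  obtain t where t: "t \<in> S" "k = Elem t \<or> index_less prin_less k (Elem t)"
    using EqRk_differ_first[OF \<beta>(1) _ S] k(1) by (metis differ_first_commute)
  have II: "j \<in> II" "k \<in> II" using j k by (auto simp: differ_first_def)
  obtain m where m: "m \<in> S" "j = Elem m \<or> index_less prin_less j (Elem m)"
    "k = Elem m \<or> index_less prin_less k (Elem m)"
    using max_in_Init[OF S(1) s(1) t(1) II(1) s(2) II(2) t(2)] by blast
  have P: "m \<in> Prin" using m S by (auto simp: Init_def)
  let ?T = "{p \<in> Prin. prin_less p m}"
  \<comment> \<open>\<open>m\<close> is in \<open>S\<close> but not strictly below itself, so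
    minimality of \<open>S\<close> makes the part of \<open>x\<close> below \<open>m\<close>
    commensurable.\<close>
  have "\<not> S \<subseteq> ?T" using m by (auto simp: prin_less_def)
  then have "commensurable \<phi> h ?T (restr ?T x)" using S(3) below_in_Init by blast
  then obtain b where b: "restr ?T x = restr ?T (hahn_map \<phi> h b)"
    by (auto simp: commensurable_def GammaQ_eq_range)
  have agree: "hahn_map \<phi> h b i = x i" if "i \<in> II" "index_less prin_less i (Elem m)" for i
  proof (cases i)
    case (Elem p)
    then show ?thesis using fun_cong[OF b, of "Elem p"] that by simp
  next
    case (Cut T)
    then show ?thesis using EqRk_Cut[OF x] by simp
  qed
  obtain l where l: "l < x (Elem m)"
    "\<And>q. (\<And>j. j \<in> II \<Longrightarrow> index_less prin_less j (Elem m) \<Longrightarrow> q j = x j) \<Longrightarrow>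
           l < q (Elem m) \<Longrightarrow> Rlex_less \<alpha> q"
    using lower_bound_at[OF j P m(2)] by blast
  obtain u where u: "x (Elem m) < u"
    "\<And>q. (\<And>j. j \<in> II \<Longrightarrow> index_less prin_less j (Elem m) \<Longrightarrow> q j = x j) \<Longrightarrow>
           q (Elem m) < u \<Longrightarrow> Rlex_less q \<beta>"
    using upper_bound_at[OF k P m(3)] by blast
  show ?thesis
    by (rule GammaQ_between[OF Q P less_trans[OF l(1) u(1)] agree l(2) u(2)])
qed

lemma between_IncRk:
  assumes Q: "\<And>i. i \<in> Prin \<Longrightarrow> Q_embedding i (\<phi> i)" "immediate_embedding h"
    and \<alpha>: "\<alpha> \<in> GammaSme \<phi> h" "Rlex_less \<alpha> x"
    and \<beta>: "\<beta> \<in> GammaSme \<phi> h" "Rlex_less x \<beta>"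
    and x: "x \<in> IncRk \<phi> h"
  shows "\<exists>q\<in>GammaQ \<phi> h. Rlex_less \<alpha> q \<and> Rlex_less q \<beta>"
proof -
  obtain j where j: "differ_first \<alpha> x j" "\<alpha> j < x j" using \<alpha> by (auto simp: Rlex_less_iff)
  obtain k where k: "differ_first x \<beta> k" "x k < \<beta> k" using \<beta> by (auto simp: Rlex_less_iff)
  have II: "j \<in> II" "k \<in> II" using j k by (auto simp: differ_first_def)
  obtain S b e where S: "S \<in> Init prin_less Prin" and e: "e = 1 \<or> e = - 1"
    and xe: "x = (restr S (hahn_map \<phi> h b))(Cut S := e)" using x by (rule IncRkE)
  have SP: "s \<in> Prin" if "s \<in> S" for s using that S by (auto simp: Init_def)
  have jS: "j = Cut S \<or> index_less prin_less j (Cut S)"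
    by (rule IncRk_differ_first[OF \<alpha>(1) j(1) S e xe])
  have kS: "k = Cut S \<or> index_less prin_less k (Cut S)"
    using IncRk_differ_first[OF \<beta>(1) _ S e xe] k(1) by (simp add: differ_first_commute)
  \<comment> \<open>For \<open>m\<close> in \<open>S\<close> the index \<open>Cut S\<close> is above
    \<open>Elem m\<close>, so the value \<open>e\<close> of \<open>x\<close> does not
    interfere.\<close>
  have agree: "hahn_map \<phi> h b i = x i"
    if "m \<in> S" "i \<in> II" "index_less prin_less i (Elem m)" for m i
    using that S by (cases i) (auto simp: xe Init_def)
  have trans: "index_less prin_less i (Cut S)"
    if "m \<in> S" "i \<in> II" "index_less prin_less i (Elem m)" for m i
    using index_less_trans[of i "Elem m" "Cut S"] that S SP by auto
  have "j \<noteq> Cut S \<or> k \<noteq> Cut S"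
  proof (rule ccontr)
    assume "\<not> ?thesis"
    then have "\<alpha> (Cut S) < e" "e < \<beta> (Cut S)" using j k by (auto simp: xe)
    then show False using e GammaSme_Cut[OF \<alpha>(1), of S] GammaSme_Cut[OF \<beta>(1), of S] by auto
  qed
  then consider "index_less prin_less j (Cut S)" "index_less prin_less k (Cut S)"
    | "j = Cut S" "index_less prin_less k (Cut S)" | "index_less prin_less j (Cut S)" "k = Cut S"
    using jS kS by blast
  then show ?thesis
  proof cases
    case 1
    obtain s where s: "s \<in> S" "j = Elem s \<or> index_less prin_less j (Elem s)"
      using below_Cut[OF 1(1)] by blast
    obtain t where t: "t \<in> S" "k = Elem t \<or> index_less prin_less k (Elem t)"
      using below_Cut[OF 1(2)] by blast
    obtain m where m: "m \<in> S" "j = Elem m \<or> index_less prin_less j (Elem m)"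
      "k = Elem m \<or> index_less prin_less k (Elem m)"
      using max_in_Init[OF S s(1) t(1) II(1) s(2) II(2) t(2)] by blast
    obtain l where l: "l < x (Elem m)"
      "\<And>q. (\<And>j. j \<in> II \<Longrightarrow> index_less prin_less j (Elem m) \<Longrightarrow> q j = x j) \<Longrightarrow>
             l < q (Elem m) \<Longrightarrow> Rlex_less \<alpha> q"
      using lower_bound_at[OF j SP[OF m(1)] m(2)] by blast
    obtain u where u: "x (Elem m) < u"
      "\<And>q. (\<And>j. j \<in> II \<Longrightarrow> index_less prin_less j (Elem m) \<Longrightarrow> q j = x j) \<Longrightarrow>
             q (Elem m) < u \<Longrightarrow> Rlex_less q \<beta>"
      using upper_bound_at[OF k SP[OF m(1)] m(3)] by blast
    show ?thesis
      by (rule GammaQ_between[OF Q SP[OF m(1)] less_trans[OF l(1) u(1)] agree[OF m(1)] l(2) u(2)])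
  next
    case 2
    obtain m where m: "m \<in> S" "k = Elem m \<or> index_less prin_less k (Elem m)"
      using below_Cut[OF 2(2)] by blast
    obtain u where u: "x (Elem m) < u"
      "\<And>q. (\<And>j. j \<in> II \<Longrightarrow> index_less prin_less j (Elem m) \<Longrightarrow> q j = x j) \<Longrightarrow>
             q (Elem m) < u \<Longrightarrow> Rlex_less q \<beta>"
      using upper_bound_at[OF k SP[OF m(1)] m(2)] by blast
    \<comment> \<open>\<alpha> agrees with \<open>x\<close> below \<open>Cut S\<close>, in
      particular at \<open>m\<close>. Hence a \<open>q\<close> that exceeds \<open>x\<close> at
      \<open>m\<close> first differs from \<alpha> there, and the coordinate of \<open>x\<close>
      itself can be the lower bound.\<close>
    have low: "Rlex_less \<alpha> q"
      if "\<And>j. j \<in> II \<Longrightarrow> index_less prin_less j (Elem m) \<Longrightarrow> q j = x j" "x (Elem m) < q (Elem m)" for q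
    proof -
      have "\<alpha> (Elem m) = x (Elem m)" using j(1) 2(1) m(1) SP by (simp add: differ_first_def)
      then show ?thesis
        using j(1) 2(1) that SP[OF m(1)] trans[OF m(1)] unfolding Rlex_less_iff
        by (intro exI[of _ "Elem m"]) (auto simp: differ_first_def)
    qed
    show ?thesis
      by (rule GammaQ_between[OF Q SP[OF m(1)] u(1) agree[OF m(1)] low u(2)])
  next
    case 3
    obtain m where m: "m \<in> S" "j = Elem m \<or> index_less prin_less j (Elem m)"
      using below_Cut[OF 3(1)] by blast
    obtain l where l: "l < x (Elem m)"
      "\<And>q. (\<And>j. j \<in> II \<Longrightarrow> index_less prin_less j (Elem m) \<Longrightarrow> q j = x j) \<Longrightarrow>
             l < q (Elem m) \<Longrightarrow> Rlex_less \<alpha> q"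
      using lower_bound_at[OF j SP[OF m(1)] m(2)] by blast
    \<comment> \<open>Symmetrically, \<beta> agrees with \<open>x\<close> at \<open>m\<close>, so
      \<open>q\<close> has to drop below \<open>x\<close> there.\<close>
    have up: "Rlex_less q \<beta>"
      if "\<And>j. j \<in> II \<Longrightarrow> index_less prin_less j (Elem m) \<Longrightarrow> q j = x j" "q (Elem m) < x (Elem m)" for q
    proof -
      have "\<beta> (Elem m) = x (Elem m)" using k(1) 3(2) m(1) SP by (simp add: differ_first_def)
      then show ?thesis
        using k(1) 3(2) that SP[OF m(1)] trans[OF m(1)] unfolding Rlex_less_iff
        by (intro exI[of _ "Elem m"]) (auto simp: differ_first_def)
    qed
    show ?thesis
      by (rule GammaQ_between[OF Q SP[OF m(1)] l(1) agree[OF m(1)] l(2) up])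
  qed
qed

theorem proposition3p2:
  fixes \<phi> :: "'a::linordered_ab_group_add dhull set \<Rightarrow> 'a dhull set \<Rightarrow> real"
    and h :: "'a dhull \<Rightarrow> 'a dhull set \<Rightarrow> 'a dhull set"
  assumes "\<And>i. i \<in> Prin \<Longrightarrow> Q_embedding i (\<phi> i)"
    and "immediate_embedding h"
  shows "\<forall>\<alpha>\<in>GammaSme \<phi> h. \<forall>\<beta>\<in>GammaSme \<phi> h.
    Rlex_less \<alpha> \<beta> \<and> {x \<in> GammaSme \<phi> h. Rlex_less \<alpha> x \<and> Rlex_less x \<beta>} \<noteq> {} \<longrightarrow>
    (\<exists>q\<in>GammaQ \<phi> h. Rlex_less \<alpha> q \<and> Rlex_less q \<beta>)"
proof (intro ballI impI)
  fix \<alpha> \<beta> assume \<alpha>: "\<alpha> \<in> GammaSme \<phi> h" and \<beta>: "\<beta> \<in> GammaSme \<phi> h"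
    and "Rlex_less \<alpha> \<beta> \<and> {x \<in> GammaSme \<phi> h. Rlex_less \<alpha> x \<and> Rlex_less x \<beta>} \<noteq> {}"
  then obtain x where x: "x \<in> GammaSme \<phi> h" "Rlex_less \<alpha> x" "Rlex_less x \<beta>" by blast
  from x(1) show "\<exists>q\<in>GammaQ \<phi> h. Rlex_less \<alpha> q \<and> Rlex_less q \<beta>"
  proof (cases rule: GammaSme_cases)
    case (Q y)
    then show ?thesis using x by (auto simp: GammaQ_eq_range)
  next
    case E
    then show ?thesis using between_EqRk[OF assms \<alpha> x(2) \<beta> x(3)] by blast
  next
    case I
    then show ?thesis using between_IncRk[OF assms \<alpha> x(2) \<beta> x(3)] by blast
  qed
qed

end
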